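(* Let $X$ and $Y$ be Banach spaces. If $X$ has the convex DLD2P, then the projective tensor product $X\widehat{\otimes}_\pi Y$ has the convex DLD2P too.
   Context: All Banach spaces are real and nontrivial (i.e. $\neq\{0\}$). $B_X$, $S_X$ denote the closed unit ball and the unit sphere of $X$. $X\widehat{\otimes}_\pi Y$ denotes the (completed) projective tensor product of $X$ and $Y$. For $x\in S_X$ and $\varepsilon>0$ let $\Delta^X_\varepsilon(x)=\{y\in B_X:\|x-y\|\ge 2-\varepsilon\}$. A point $x\in S_X$ is a $\Delta$-point of $X$ if $x\in\overline{\mathrm{conv}}\,\Delta^X_\varepsilon(x)$ (norm-closed convex hull) for every $\varepsilon>0$; $\Delta_X$ denotes the set of all $\Delta$-points of $X$. $X$ has the convex diametral local diameter two property (convex DLD2P) if $B_X=\overline{\mathrm{conv}}\,\Delta_X$. *)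

theory Defs
  imports "HOL-Analysis.Analysis" "HOL-Analysis.Finite_Function_Topology"
begin

section \<open>The algebraic tensor product\<close>

definition free_pair :: "'a \<Rightarrow> 'b \<Rightarrow> ('a \<times> 'b) \<Rightarrow>\<^sub>0 real"
  where "free_pair x y = Poly_Mapping.single (x, y) 1"

definition bilinear_relators :: "(('a::real_vector \<times> 'b::real_vector) \<Rightarrow>\<^sub>0 real) set"
  where "bilinear_relators =
    {free_pair (x + x') y - free_pair x y - free_pair x' y | x x' y. True} \<union>
    {free_pair x (y + y') - free_pair x y - free_pair x y' | x y y'. True} \<union>
    {free_pair (c *\<^sub>R x) y - c *\<^sub>R free_pair x y | c x y. True} \<union>
    {free_pair x (c *\<^sub>R y) - c *\<^sub>R free_pair x y | c x y. True}"

definition tensor_eq ::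
  "(('a::real_vector \<times> 'b::real_vector) \<Rightarrow>\<^sub>0 real) \<Rightarrow> (('a \<times> 'b) \<Rightarrow>\<^sub>0 real) \<Rightarrow> bool"
  where "tensor_eq u v \<longleftrightarrow> u - v \<in> span bilinear_relators"

lemma equivp_tensor_eq: "equivp tensor_eq" (is "equivp ?R")
proof (rule equivpI)
  show "reflp ?R"
    by (auto simp: reflp_def tensor_eq_def span_zero)
  show "symp ?R"
  proof (rule sympI)
    fix u v :: "('a \<times> 'b) \<Rightarrow>\<^sub>0 real"
    assume "tensor_eq u v"
    then have "- (u - v) \<in> span bilinear_relators"
      unfolding tensor_eq_def by (rule span_neg)
    then show "tensor_eq v u" by (simp add: tensor_eq_def)
  qed
  show "transp ?R"
  proof (rule transpI)
    fix u v w :: "('a \<times> 'b) \<Rightarrow>\<^sub>0 real"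
    assume "tensor_eq u v" "tensor_eq v w"
    then have "(u - v) + (v - w) \<in> span bilinear_relators"
      unfolding tensor_eq_def by (rule span_add)
    then show "tensor_eq u w" by (simp add: tensor_eq_def)
  qed
qed

text \<open>The free real vector space on \<open>'a \<times> 'b\<close> modulo the span of the bilinearity relations.\<close>

quotient_type (overloaded) ('a, 'b) alg_tensor =
  "('a::real_vector \<times> 'b::real_vector) \<Rightarrow>\<^sub>0 real" / tensor_eq
  by (rule equivp_tensor_eq)

instantiation alg_tensor :: (real_vector, real_vector) real_vector
begin

lift_definition zero_alg_tensor :: "('a, 'b) alg_tensor" is 0 .

lift_definition plus_alg_tensor ::
  "('a, 'b) alg_tensor \<Rightarrow> ('a, 'b) alg_tensor \<Rightarrow> ('a, 'b) alg_tensor" is "(+)"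
proof -
  fix u u' v v' :: "('a \<times> 'b) \<Rightarrow>\<^sub>0 real"
  assume "tensor_eq u u'" "tensor_eq v v'"
  then have "(u - u') + (v - v') \<in> span bilinear_relators"
    unfolding tensor_eq_def by (rule span_add)
  then show "tensor_eq (u + v) (u' + v')" by (simp add: tensor_eq_def algebra_simps)
qed

lift_definition uminus_alg_tensor :: "('a, 'b) alg_tensor \<Rightarrow> ('a, 'b) alg_tensor" is uminus
proof -
  fix u u' :: "('a \<times> 'b) \<Rightarrow>\<^sub>0 real"
  assume "tensor_eq u u'"
  then have "- (u - u') \<in> span bilinear_relators"
    unfolding tensor_eq_def by (rule span_neg)
  then show "tensor_eq (- u) (- u')" by (simp add: tensor_eq_def algebra_simps)
qed

lift_definition minus_alg_tensor ::
  "('a, 'b) alg_tensor \<Rightarrow> ('a, 'b) alg_tensor \<Rightarrow> ('a, 'b) alg_tensor" is "(-)"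
proof -
  fix u u' v v' :: "('a \<times> 'b) \<Rightarrow>\<^sub>0 real"
  assume "tensor_eq u u'" "tensor_eq v v'"
  then have "(u - u') - (v - v') \<in> span bilinear_relators"
    unfolding tensor_eq_def by (rule span_diff)
  then show "tensor_eq (u - v) (u' - v')" by (simp add: tensor_eq_def algebra_simps)
qed

lift_definition scaleR_alg_tensor ::
  "real \<Rightarrow> ('a, 'b) alg_tensor \<Rightarrow> ('a, 'b) alg_tensor" is scaleR
proof -
  fix c :: real and u u' :: "('a \<times> 'b) \<Rightarrow>\<^sub>0 real"
  assume "tensor_eq u u'"
  then have "c *\<^sub>R (u - u') \<in> span bilinear_relators"
    unfolding tensor_eq_def by (rule span_scale)
  then show "tensor_eq (c *\<^sub>R u) (c *\<^sub>R u')"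
    by (simp add: tensor_eq_def scaleR_diff_right)
qed

instance
  by standard
    (transfer; simp add: tensor_eq_def span_zero algebra_simps)+

end

lift_definition alg_tensor_pair :: "'a::real_vector \<Rightarrow> 'b::real_vector \<Rightarrow> ('a, 'b) alg_tensor"
  is free_pair .

lemma alg_tensor_pair_scaleR_left: "alg_tensor_pair (c *\<^sub>R x) y = c *\<^sub>R alg_tensor_pair x y"
  by transfer (unfold tensor_eq_def, rule span_base, unfold bilinear_relators_def, blast)

lemma alg_tensor_pair_scaleR_right: "alg_tensor_pair x (c *\<^sub>R y) = c *\<^sub>R alg_tensor_pair x y"
  by transfer (unfold tensor_eq_def, rule span_base, unfold bilinear_relators_def, blast)

lemma alg_tensor_pair_add_left:
  "alg_tensor_pair (x + x') y = alg_tensor_pair x y + alg_tensor_pair x' y"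
proof transfer
  fix x x' :: 'a and y :: 'b
  have "free_pair (x + x') y - free_pair x y - free_pair x' y \<in> bilinear_relators"
    unfolding bilinear_relators_def by blast
  then show "tensor_eq (free_pair (x + x') y) (free_pair x y + free_pair x' y)"
    by (simp add: tensor_eq_def diff_diff_eq span_base)
qed

lemma alg_tensor_pair_add_right:
  "alg_tensor_pair x (y + y') = alg_tensor_pair x y + alg_tensor_pair x y'"
proof transfer
  fix x :: 'a and y y' :: 'b
  have "free_pair x (y + y') - free_pair x y - free_pair x y' \<in> bilinear_relators"
    unfolding bilinear_relators_def by blast
  then show "tensor_eq (free_pair x (y + y')) (free_pair x y + free_pair x y')"
    by (simp add: tensor_eq_def diff_diff_eq span_base)
qed

lemma bilinear_alg_tensor_pair: "bilinear alg_tensor_pair"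
  unfolding bilinear_def
  by (intro conjI allI linearI)
    (simp_all add: alg_tensor_pair_add_left alg_tensor_pair_add_right
      alg_tensor_pair_scaleR_left alg_tensor_pair_scaleR_right)

lemma lookup_scaleR: "Poly_Mapping.lookup (c *\<^sub>R u) i = c *\<^sub>R Poly_Mapping.lookup u i"
proof -
  have "finite {i. c *\<^sub>R Poly_Mapping.lookup u i \<noteq> 0}"
    by (rule finite_subset[OF _ finite_keys[of u]]) (auto simp: in_keys_iff)
  then show ?thesis by (simp add: scaleR_poly_mapping_def Abs_poly_mapping_inverse)
qed

lemma free_pair_expansion:
  fixes u :: "('a::real_vector \<times> 'b::real_vector) \<Rightarrow>\<^sub>0 real"
  shows "\<exists>ps. u = (\<Sum>(c, x, y)\<leftarrow>ps. c *\<^sub>R free_pair x y)"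
proof (induction u rule: update_induct)
  case const
  have "0 = (\<Sum>(c, x, y)\<leftarrow>[]. c *\<^sub>R free_pair x y)" by simp
  then show ?case by blast
next
  case (update f a b)
  then obtain ps where ps: "f = (\<Sum>(c, x, y)\<leftarrow>ps. c *\<^sub>R free_pair x y)" by blast
  have "Poly_Mapping.update a b f = b *\<^sub>R free_pair (fst a) (snd a) + f"
    using update.hyps
    by (intro poly_mapping_eqI)
      (auto simp: lookup_update lookup_add free_pair_def lookup_single lookup_scaleR when_def in_keys_iff)
  then have "Poly_Mapping.update a b f =
      (\<Sum>(c, x, y)\<leftarrow>(b, fst a, snd a) # ps. c *\<^sub>R free_pair x y)"
    by (simp add: ps case_prod_beta)
  then show ?case by blast
qed

lemma alg_tensor_expansion:
  fixes u :: "('a::real_vector, 'b::real_vector) alg_tensor"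
  shows "\<exists>ps. u = (\<Sum>(x, y)\<leftarrow>ps. alg_tensor_pair x y)"
proof (induction u rule: alg_tensor.abs_induct)
  case (1 v)
  obtain qs where qs: "v = (\<Sum>(c, x, y)\<leftarrow>qs. c *\<^sub>R free_pair x y)"
    using free_pair_expansion by blast
  have "abs_alg_tensor (\<Sum>(c, x, y)\<leftarrow>qs. c *\<^sub>R free_pair x y) =
      (\<Sum>(x, y)\<leftarrow>map (\<lambda>(c, x, y). (c *\<^sub>R x, y)) qs. alg_tensor_pair x y)"
  proof (induction qs)
    case Nil
    then show ?case by (simp add: zero_alg_tensor_def)
  next
    case (Cons q qs)
    obtain c x y where q: "q = (c, x, y)" by (cases q)
    have "abs_alg_tensor (c *\<^sub>R free_pair x y) = alg_tensor_pair (c *\<^sub>R x) y"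
      by (simp only: alg_tensor_pair_scaleR_left) (simp only: alg_tensor_pair.abs_eq scaleR_alg_tensor.abs_eq)
    then show ?case
      using Cons by (simp add: q flip: plus_alg_tensor.abs_eq)
  qed
  then show ?case using qs by blast
qed


section \<open>The projective norm\<close>

text \<open>
  The usual formula: the infimum of \<open>\<Sum>i. norm (x i) * norm (y i)\<close> over all finite representations
  \<open>u = (\<Sum>i. x i \<otimes> y i)\<close>. Every tensor has such a representation (scalars being absorbed into the
  left factors, see \<open>alg_tensor_expansion\<close>), so the infimum is over a nonempty set.
\<close>

definition proj_norm :: "('a::real_normed_vector, 'b::real_normed_vector) alg_tensor \<Rightarrow> real"
  where "proj_norm u =
    Inf {\<Sum>(x, y)\<leftarrow>ps. norm x * norm y | ps. u = (\<Sum>(x, y)\<leftarrow>ps. alg_tensor_pair x y)}"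

lemma proj_cost_nonneg:
  fixes ps :: "('a::real_normed_vector \<times> 'b::real_normed_vector) list"
  shows "0 \<le> (\<Sum>(x, y)\<leftarrow>ps. norm x * norm y)"
  by (rule sum_list_nonneg) auto

lemma proj_norm_le:
  "u = (\<Sum>(x, y)\<leftarrow>ps. alg_tensor_pair x y) \<Longrightarrow> proj_norm u \<le> (\<Sum>(x, y)\<leftarrow>ps. norm x * norm y)"
  unfolding proj_norm_def
  by (rule cInf_lower) (auto intro!: bdd_belowI[of _ 0] proj_cost_nonneg)

lemma proj_norm_greatest:
  assumes "\<And>ps. u = (\<Sum>(x, y)\<leftarrow>ps. alg_tensor_pair x y) \<Longrightarrow> B \<le> (\<Sum>(x, y)\<leftarrow>ps. norm x * norm y)"
  shows "B \<le> proj_norm u"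
  unfolding proj_norm_def using alg_tensor_expansion[of u] assms
  by (intro cInf_greatest) auto

lemma proj_norm_approx:
  assumes "0 < e"
  obtains ps where "u = (\<Sum>(x, y)\<leftarrow>ps. alg_tensor_pair x y)"
    "(\<Sum>(x, y)\<leftarrow>ps. norm x * norm y) < proj_norm u + e"
proof -
  have "\<not> proj_norm u + e \<le> proj_norm u" using assms by simp
  then show thesis using proj_norm_greatest[of u "proj_norm u + e"] that by (meson not_le)
qed

lemma proj_norm_nonneg: "0 \<le> proj_norm u"
  by (rule proj_norm_greatest) (rule proj_cost_nonneg)

lemma proj_norm_zero: "proj_norm (0 :: ('a::real_normed_vector, 'b::real_normed_vector) alg_tensor) = 0"
  using proj_norm_le[of "0 :: ('a, 'b) alg_tensor" "[]"]
    proj_norm_nonneg[of "0 :: ('a, 'b) alg_tensor"] by simp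

lemma proj_norm_triangle: "proj_norm (u + v) \<le> proj_norm u + proj_norm v"
proof (rule field_le_epsilon)
  fix e :: real
  assume "0 < e"
  then have e: "0 < e / 2" by simp
  obtain ps where ps: "u = (\<Sum>(x, y)\<leftarrow>ps. alg_tensor_pair x y)"
    "(\<Sum>(x, y)\<leftarrow>ps. norm x * norm y) < proj_norm u + e / 2"
    using proj_norm_approx[OF e] .
  obtain qs where qs: "v = (\<Sum>(x, y)\<leftarrow>qs. alg_tensor_pair x y)"
    "(\<Sum>(x, y)\<leftarrow>qs. norm x * norm y) < proj_norm v + e / 2"
    using proj_norm_approx[OF e] .
  have "proj_norm (u + v) \<le> (\<Sum>(x, y)\<leftarrow>ps @ qs. norm x * norm y)"
    by (rule proj_norm_le) (simp add: ps(1) qs(1))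
  then show "proj_norm (u + v) \<le> proj_norm u + proj_norm v + e"
    using ps(2) qs(2) by simp
qed

lemma proj_norm_scaleR_le: "proj_norm (c *\<^sub>R u) \<le> \<bar>c\<bar> * proj_norm u"
proof (cases "c = 0")
  case True
  then show ?thesis by (simp add: proj_norm_zero)
next
  case False
  have "proj_norm (c *\<^sub>R u) / \<bar>c\<bar> \<le> proj_norm u"
  proof (rule proj_norm_greatest)
    fix ps
    assume ps: "u = (\<Sum>(x, y)\<leftarrow>ps. alg_tensor_pair x y)"
    let ?qs = "map (\<lambda>(x, y). (c *\<^sub>R x, y)) ps"
    have "c *\<^sub>R (\<Sum>(x, y)\<leftarrow>ps. alg_tensor_pair x y) = (\<Sum>(x, y)\<leftarrow>?qs. alg_tensor_pair x y)"
      by (induction ps) (auto simp: alg_tensor_pair_scaleR_left scaleR_add_right)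
    then have "proj_norm (c *\<^sub>R u) \<le> (\<Sum>(x, y)\<leftarrow>?qs. norm x * norm y)"
      using ps by (intro proj_norm_le) simp
    also have "\<dots> = \<bar>c\<bar> * (\<Sum>(x, y)\<leftarrow>ps. norm x * norm y)"
      by (induction ps) (auto simp: algebra_simps)
    finally show "proj_norm (c *\<^sub>R u) / \<bar>c\<bar> \<le> (\<Sum>(x, y)\<leftarrow>ps. norm x * norm y)"
      using False by (simp add: divide_le_eq mult.commute)
  qed
  then show ?thesis using False by (simp add: divide_le_eq mult.commute)
qed

lemma proj_norm_scaleR: "proj_norm (c *\<^sub>R u) = \<bar>c\<bar> * proj_norm u"
proof (cases "c = 0")
  case True
  then show ?thesis by (simp add: proj_norm_zero)
next
  case False
  have "proj_norm (inverse c *\<^sub>R c *\<^sub>R u) \<le> \<bar>inverse c\<bar> * proj_norm (c *\<^sub>R u)"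
    by (rule proj_norm_scaleR_le)
  then have "\<bar>c\<bar> * proj_norm u \<le> proj_norm (c *\<^sub>R u)"
    using False by (simp add: field_simps)
  then show ?thesis using proj_norm_scaleR_le[of c u] by simp
qed

lemma proj_norm_minus: "proj_norm (- u) = proj_norm u"
  using proj_norm_scaleR[of "-1" u] by simp

lemma proj_norm_minus_commute: "proj_norm (u - v) = proj_norm (v - u)"
  using proj_norm_minus[of "u - v"] by simp

lemma proj_norm_triangle_diff: "proj_norm (u - w) \<le> proj_norm (u - v) + proj_norm (v - w)"
  using proj_norm_triangle[of "u - v" "v - w"] by simp

lemma proj_norm_rev_triangle: "\<bar>proj_norm u - proj_norm v\<bar> \<le> proj_norm (u - v)"
  using proj_norm_triangle[of "u - v" v] proj_norm_triangle[of "v - u" u]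
    proj_norm_minus_commute[of u v] by simp


section \<open>The completed projective tensor product\<close>

definition proj_Cauchy ::
  "(nat \<Rightarrow> ('a::real_normed_vector, 'b::real_normed_vector) alg_tensor) \<Rightarrow> bool"
  where "proj_Cauchy S \<longleftrightarrow> (\<forall>e>0. \<exists>N. \<forall>m\<ge>N. \<forall>n\<ge>N. proj_norm (S m - S n) < e)"

definition proj_Cauchy_eq ::
  "(nat \<Rightarrow> ('a::real_normed_vector, 'b::real_normed_vector) alg_tensor) \<Rightarrow>
   (nat \<Rightarrow> ('a, 'b) alg_tensor) \<Rightarrow> bool"
  where "proj_Cauchy_eq S T \<longleftrightarrow>
    proj_Cauchy S \<and> proj_Cauchy T \<and> (\<lambda>n. proj_norm (S n - T n)) \<longlonglongrightarrow> 0"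

lemma proj_Cauchy_const: "proj_Cauchy (\<lambda>n. u)"
  by (simp add: proj_Cauchy_def proj_norm_zero)

lemma proj_null_bound:
  assumes "a \<longlonglongrightarrow> 0" "\<And>n. proj_norm (S n) \<le> a n"
  shows "(\<lambda>n. proj_norm (S n)) \<longlonglongrightarrow> 0"
  by (rule tendsto_sandwich[OF _ _ tendsto_const assms(1)])
    (auto simp: proj_norm_nonneg assms(2))

lemma part_equivp_proj_Cauchy_eq: "part_equivp proj_Cauchy_eq" (is "part_equivp ?R")
proof (rule part_equivpI)
  have "?R (\<lambda>n. 0) (\<lambda>n. 0)"
    by (simp add: proj_Cauchy_eq_def proj_Cauchy_const proj_norm_zero)
  then show "\<exists>S. ?R S S" by blast
  show "symp ?R"
    by (auto intro!: sympI simp: proj_Cauchy_eq_def proj_norm_minus_commute)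
  show "transp ?R"
  proof (rule transpI)
    fix S T U :: "nat \<Rightarrow> ('a, 'b) alg_tensor"
    assume ST: "proj_Cauchy_eq S T" and TU: "proj_Cauchy_eq T U"
    have "(\<lambda>n. proj_norm (S n - T n) + proj_norm (T n - U n)) \<longlonglongrightarrow> 0 + 0"
      using ST TU unfolding proj_Cauchy_eq_def by (intro tendsto_add) auto
    then have "(\<lambda>n. proj_norm (S n - U n)) \<longlonglongrightarrow> 0"
      by (intro proj_null_bound[where a = "\<lambda>n. proj_norm (S n - T n) + proj_norm (T n - U n)"]
          proj_norm_triangle_diff) simp
    then show "proj_Cauchy_eq S U"
      using ST TU by (simp add: proj_Cauchy_eq_def)
  qed
qed

lemma proj_Cauchy_add:
  assumes "proj_Cauchy S" "proj_Cauchy T"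
  shows "proj_Cauchy (\<lambda>n. S n + T n)"
  unfolding proj_Cauchy_def
proof (intro allI impI)
  fix e :: real
  assume "0 < e"
  then have e: "0 < e / 2" by simp
  obtain M where M: "\<And>m n. m \<ge> M \<Longrightarrow> n \<ge> M \<Longrightarrow> proj_norm (S m - S n) < e / 2"
    using assms(1) e unfolding proj_Cauchy_def by blast
  obtain N where N: "\<And>m n. m \<ge> N \<Longrightarrow> n \<ge> N \<Longrightarrow> proj_norm (T m - T n) < e / 2"
    using assms(2) e unfolding proj_Cauchy_def by blast
  have "proj_norm (S m + T m - (S n + T n)) < e" if "m \<ge> max M N" "n \<ge> max M N" for m n
    using proj_norm_triangle[of "S m - S n" "T m - T n"] M[of m n] N[of m n] that
    by (simp add: algebra_simps)
  then show "\<exists>K. \<forall>m\<ge>K. \<forall>n\<ge>K. proj_norm (S m + T m - (S n + T n)) < e" by blast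
qed

lemma proj_Cauchy_scaleR:
  assumes "proj_Cauchy S"
  shows "proj_Cauchy (\<lambda>n. c *\<^sub>R S n)"
  unfolding proj_Cauchy_def
proof (intro allI impI)
  fix e :: real
  assume "0 < e"
  then have e: "0 < e / (\<bar>c\<bar> + 1)" by simp
  obtain N where N: "\<And>m n. m \<ge> N \<Longrightarrow> n \<ge> N \<Longrightarrow> proj_norm (S m - S n) < e / (\<bar>c\<bar> + 1)"
    using assms e unfolding proj_Cauchy_def by blast
  have "proj_norm (c *\<^sub>R S m - c *\<^sub>R S n) < e" if "m \<ge> N" "n \<ge> N" for m n
  proof -
    have "proj_norm (c *\<^sub>R S m - c *\<^sub>R S n) = \<bar>c\<bar> * proj_norm (S m - S n)"
      by (simp add: proj_norm_scaleR flip: scaleR_diff_right)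
    also have "\<dots> \<le> (\<bar>c\<bar> + 1) * proj_norm (S m - S n)"
      by (simp add: mult_right_mono proj_norm_nonneg)
    also have "\<dots> < e" using N[OF that] by (simp add: field_simps)
    finally show ?thesis .
  qed
  then show "\<exists>N. \<forall>m\<ge>N. \<forall>n\<ge>N. proj_norm (c *\<^sub>R S m - c *\<^sub>R S n) < e" by blast
qed

lemma proj_Cauchy_minus: "proj_Cauchy S \<Longrightarrow> proj_Cauchy (\<lambda>n. - S n)"
  using proj_Cauchy_scaleR[of S "-1"] by simp

lemma proj_Cauchy_diff: "proj_Cauchy S \<Longrightarrow> proj_Cauchy T \<Longrightarrow> proj_Cauchy (\<lambda>n. S n - T n)"
  using proj_Cauchy_add[of S "\<lambda>n. - T n"] proj_Cauchy_minus[of T] by simp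

lemma proj_Cauchy_convergent:
  assumes "proj_Cauchy S"
  shows "convergent (\<lambda>n. proj_norm (S n))"
proof -
  have "Cauchy (\<lambda>n. proj_norm (S n))"
    unfolding Cauchy_def dist_real_def
    using assms proj_norm_rev_triangle unfolding proj_Cauchy_def by (meson order_le_less_trans)
  then show ?thesis by (simp add: Cauchy_convergent_iff)
qed

lemma proj_Cauchy_LIMSEQ:
  "proj_Cauchy S \<Longrightarrow> (\<lambda>n. proj_norm (S n)) \<longlonglongrightarrow> lim (\<lambda>n. proj_norm (S n))"
  using proj_Cauchy_convergent by (simp add: convergent_LIMSEQ_iff)

lifting_forget alg_tensor.lifting

text \<open>
  The completion: \<^const>\<open>proj_norm\<close>-Cauchy sequences of algebraic tensors, modulo null
  sequences. Factoring out null sequences yields a normed space using only that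
  \<^const>\<open>proj_norm\<close> is a seminorm; that it is in fact a norm on the algebraic tensor product
  is not needed for the construction.
\<close>

quotient_type (overloaded) ('a, 'b) proj_tensor =
  "nat \<Rightarrow> ('a::real_normed_vector, 'b::real_normed_vector) alg_tensor" / partial: proj_Cauchy_eq
  by (rule part_equivp_proj_Cauchy_eq)

instantiation proj_tensor :: (real_normed_vector, real_normed_vector) real_vector
begin

lift_definition zero_proj_tensor :: "('a, 'b) proj_tensor" is "\<lambda>n. 0"
  by (simp add: proj_Cauchy_eq_def proj_Cauchy_const proj_norm_zero)

lift_definition plus_proj_tensor ::
  "('a, 'b) proj_tensor \<Rightarrow> ('a, 'b) proj_tensor \<Rightarrow> ('a, 'b) proj_tensor"
  is "\<lambda>S T n. S n + T n"
proof -
  fix S S' T T' :: "nat \<Rightarrow> ('a, 'b) alg_tensor"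
  assume S: "proj_Cauchy_eq S S'" and T: "proj_Cauchy_eq T T'"
  have "(\<lambda>n. proj_norm (S n - S' n) + proj_norm (T n - T' n)) \<longlonglongrightarrow> 0 + 0"
    using S T unfolding proj_Cauchy_eq_def by (intro tendsto_add) auto
  moreover have "proj_norm (S n + T n - (S' n + T' n))
      \<le> proj_norm (S n - S' n) + proj_norm (T n - T' n)" for n
    using proj_norm_triangle[of "S n - S' n" "T n - T' n"] by (simp add: algebra_simps)
  ultimately have "(\<lambda>n. proj_norm (S n + T n - (S' n + T' n))) \<longlonglongrightarrow> 0"
    by (intro proj_null_bound[where a = "\<lambda>n. proj_norm (S n - S' n) + proj_norm (T n - T' n)"])
      simp_all
  then show "proj_Cauchy_eq (\<lambda>n. S n + T n) (\<lambda>n. S' n + T' n)"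
    using S T by (simp add: proj_Cauchy_eq_def proj_Cauchy_add)
qed

lift_definition scaleR_proj_tensor ::
  "real \<Rightarrow> ('a, 'b) proj_tensor \<Rightarrow> ('a, 'b) proj_tensor" is "\<lambda>c S n. c *\<^sub>R S n"
proof -
  fix c :: real and S S' :: "nat \<Rightarrow> ('a, 'b) alg_tensor"
  assume S: "proj_Cauchy_eq S S'"
  have "(\<lambda>n. \<bar>c\<bar> * proj_norm (S n - S' n)) \<longlonglongrightarrow> \<bar>c\<bar> * 0"
    using S unfolding proj_Cauchy_eq_def by (intro tendsto_mult tendsto_const) auto
  then have "(\<lambda>n. proj_norm (c *\<^sub>R S n - c *\<^sub>R S' n)) \<longlonglongrightarrow> 0"
    by (simp add: proj_norm_scaleR flip: scaleR_diff_right)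
  then show "proj_Cauchy_eq (\<lambda>n. c *\<^sub>R S n) (\<lambda>n. c *\<^sub>R S' n)"
    using S by (simp add: proj_Cauchy_eq_def proj_Cauchy_scaleR)
qed

lift_definition uminus_proj_tensor ::
  "('a, 'b) proj_tensor \<Rightarrow> ('a, 'b) proj_tensor" is "\<lambda>S n. - S n"
  by (auto simp: proj_Cauchy_eq_def proj_Cauchy_minus proj_norm_minus_commute)

lift_definition minus_proj_tensor ::
  "('a, 'b) proj_tensor \<Rightarrow> ('a, 'b) proj_tensor \<Rightarrow> ('a, 'b) proj_tensor"
  is "\<lambda>S T n. S n - T n"
proof -
  fix S S' T T' :: "nat \<Rightarrow> ('a, 'b) alg_tensor"
  assume S: "proj_Cauchy_eq S S'" and T: "proj_Cauchy_eq T T'"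
  have "(\<lambda>n. proj_norm (S n - S' n) + proj_norm (T' n - T n)) \<longlonglongrightarrow> 0 + 0"
    using S T unfolding proj_Cauchy_eq_def
    by (intro tendsto_add) (auto simp: proj_norm_minus_commute)
  moreover have "proj_norm (S n - T n - (S' n - T' n))
      \<le> proj_norm (S n - S' n) + proj_norm (T' n - T n)" for n
    using proj_norm_triangle[of "S n - S' n" "T' n - T n"] by (simp add: algebra_simps)
  ultimately have "(\<lambda>n. proj_norm (S n - T n - (S' n - T' n))) \<longlonglongrightarrow> 0"
    by (intro proj_null_bound[where a = "\<lambda>n. proj_norm (S n - S' n) + proj_norm (T' n - T n)"])
      simp_all
  then show "proj_Cauchy_eq (\<lambda>n. S n - T n) (\<lambda>n. S' n - T' n)"
    using S T by (simp add: proj_Cauchy_eq_def proj_Cauchy_diff)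
qed

instance
  by standard
    (transfer; simp add: proj_Cauchy_eq_def proj_Cauchy_add proj_Cauchy_scaleR
      proj_Cauchy_minus proj_Cauchy_diff proj_Cauchy_const proj_norm_zero algebra_simps)+

end

instantiation proj_tensor :: (real_normed_vector, real_normed_vector) real_normed_vector
begin

lift_definition norm_proj_tensor :: "('a, 'b) proj_tensor \<Rightarrow> real"
  is "\<lambda>S. lim (\<lambda>n. proj_norm (S n))"
proof -
  fix S T :: "nat \<Rightarrow> ('a, 'b) alg_tensor"
  assume ST: "proj_Cauchy_eq S T"
  have "(\<lambda>n. proj_norm (S n) - proj_norm (T n)) \<longlonglongrightarrow> 0"
    by (rule tendsto_rabs_zero_cancel,
        rule tendsto_sandwich[where f = "\<lambda>n. 0" and h = "\<lambda>n. proj_norm (S n - T n)"])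
      (use ST in \<open>auto simp: proj_Cauchy_eq_def proj_norm_rev_triangle\<close>)
  moreover have "(\<lambda>n. proj_norm (S n) - proj_norm (T n)) \<longlonglongrightarrow>
      lim (\<lambda>n. proj_norm (S n)) - lim (\<lambda>n. proj_norm (T n))"
    using ST unfolding proj_Cauchy_eq_def by (intro tendsto_diff proj_Cauchy_LIMSEQ) auto
  ultimately show "lim (\<lambda>n. proj_norm (S n)) = lim (\<lambda>n. proj_norm (T n))"
    using LIMSEQ_unique by fastforce
qed

definition sgn_proj_tensor :: "('a, 'b) proj_tensor \<Rightarrow> ('a, 'b) proj_tensor"
  where "sgn_proj_tensor u = u /\<^sub>R norm u"

definition dist_proj_tensor :: "('a, 'b) proj_tensor \<Rightarrow> ('a, 'b) proj_tensor \<Rightarrow> real"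
  where "dist_proj_tensor u v = norm (u - v)"

definition uniformity_proj_tensor :: "(('a, 'b) proj_tensor \<times> ('a, 'b) proj_tensor) filter"
  where "uniformity_proj_tensor =
    (INF e\<in>{0<..}. principal {(u, v). dist (u :: ('a, 'b) proj_tensor) v < e})"

definition open_proj_tensor :: "('a, 'b) proj_tensor set \<Rightarrow> bool"
  where "open_proj_tensor U \<longleftrightarrow> (\<forall>u\<in>U. \<forall>\<^sub>F (u', v) in uniformity. u' = u \<longrightarrow> v \<in> U)"

instance
proof
  fix u v :: "('a, 'b) proj_tensor" and c :: real
  show "dist u v = norm (u - v)" by (rule dist_proj_tensor_def)
  show "sgn u = u /\<^sub>R norm u" by (rule sgn_proj_tensor_def)
  show "(norm u = 0) = (u = 0)"
    by transfer
      (auto simp: proj_Cauchy_eq_def proj_Cauchy_const dest: proj_Cauchy_LIMSEQ intro: limI)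
  show "norm (u + v) \<le> norm u + norm v"
    by transfer
      (auto simp: proj_Cauchy_eq_def
        intro!: LIMSEQ_le[OF proj_Cauchy_LIMSEQ tendsto_add[OF proj_Cauchy_LIMSEQ proj_Cauchy_LIMSEQ]]
          proj_Cauchy_add proj_norm_triangle)
  show "norm (c *\<^sub>R u) = \<bar>c\<bar> * norm u"
    by transfer
      (auto simp: proj_Cauchy_eq_def proj_norm_scaleR
        intro!: limI tendsto_mult proj_Cauchy_LIMSEQ)
qed (rule uniformity_proj_tensor_def open_proj_tensor_def)+

end

lift_definition of_alg_tensor ::
  "('a::real_normed_vector, 'b::real_normed_vector) alg_tensor \<Rightarrow> ('a, 'b) proj_tensor"
  is "\<lambda>u n. u"
  by (simp add: proj_Cauchy_eq_def proj_Cauchy_const proj_norm_zero)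

lemma of_alg_tensor_diff: "of_alg_tensor (u - v) = of_alg_tensor u - of_alg_tensor v"
  by transfer (simp add: proj_Cauchy_eq_def proj_Cauchy_const proj_norm_zero)

lemma linear_of_alg_tensor: "linear of_alg_tensor"
  by (rule linearI; transfer) (simp_all add: proj_Cauchy_eq_def proj_Cauchy_const proj_norm_zero)

lemma norm_of_alg_tensor: "norm (of_alg_tensor u) = proj_norm u"
  by transfer simp

lemma of_alg_tensor_LIMSEQ:
  assumes S: "proj_Cauchy S"
  shows "(\<lambda>n. of_alg_tensor (S n)) \<longlonglongrightarrow> abs_proj_tensor S"
proof (rule LIMSEQ_I)
  fix r :: real
  assume "0 < r"
  then obtain N where N: "\<And>m n. m \<ge> N \<Longrightarrow> n \<ge> N \<Longrightarrow> proj_norm (S m - S n) < r / 2"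
    using S unfolding proj_Cauchy_def by (meson half_gt_zero)
  have "norm (of_alg_tensor (S n) - abs_proj_tensor S) < r" if "n \<ge> N" for n
  proof -
    have "norm (of_alg_tensor (S n) - abs_proj_tensor S) = lim (\<lambda>k. proj_norm (S n - S k))"
      using S
      by (simp add: of_alg_tensor.abs_eq minus_proj_tensor.abs_eq norm_proj_tensor.abs_eq
          eq_onp_def proj_Cauchy_eq_def proj_Cauchy_const proj_Cauchy_diff proj_norm_zero)
    moreover have "(\<lambda>k. proj_norm (S n - S k)) \<longlonglongrightarrow> lim (\<lambda>k. proj_norm (S n - S k))"
      using S by (intro proj_Cauchy_LIMSEQ proj_Cauchy_diff proj_Cauchy_const)
    then have "lim (\<lambda>k. proj_norm (S n - S k)) \<le> r / 2"
      by (rule LIMSEQ_le_const2) (use N[OF that] in \<open>auto intro: less_imp_le\<close>)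
    ultimately have "norm (of_alg_tensor (S n) - abs_proj_tensor S) \<le> r / 2" by simp
    then show ?thesis using \<open>0 < r\<close> by simp
  qed
  then show "\<exists>N. \<forall>n\<ge>N. norm (of_alg_tensor (S n) - abs_proj_tensor S) < r" by blast
qed

lemma of_alg_tensor_dense: "closure (range of_alg_tensor) = UNIV"
proof -
  have "u \<in> closure (range of_alg_tensor)" for u :: "('a, 'b) proj_tensor"
  proof (induction u rule: proj_tensor.abs_induct)
    case (1 S)
    then have "(\<lambda>n. of_alg_tensor (S n)) \<longlonglongrightarrow> abs_proj_tensor S"
      by (intro of_alg_tensor_LIMSEQ) (simp add: proj_Cauchy_eq_def)
    then show ?case
      unfolding closure_sequential
      by (intro exI[of _ "\<lambda>n. of_alg_tensor (S n)"] conjI allI rangeI)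
  qed
  then show ?thesis by auto
qed

instance proj_tensor :: (real_normed_vector, real_normed_vector) banach
proof
  fix X :: "nat \<Rightarrow> ('a, 'b) proj_tensor"
  assume X: "Cauchy X"
  have "\<exists>s. norm (of_alg_tensor s - X n) < inverse (real (Suc n))" for n
    using of_alg_tensor_dense closure_approachable[of "X n" "range of_alg_tensor"]
    by (force simp: dist_norm)
  then obtain S where S: "\<And>n. norm (of_alg_tensor (S n) - X n) < inverse (real (Suc n))"
    by metis
  have null: "(\<lambda>n. of_alg_tensor (S n) - X n) \<longlonglongrightarrow> 0"
    by (rule Lim_null_comparison[OF _ LIMSEQ_inverse_real_of_nat])
      (use S in \<open>auto intro!: always_eventually less_imp_le\<close>)
  have "Cauchy (\<lambda>n. of_alg_tensor (S n))"
  proof (rule CauchyI)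
    fix e :: real
    assume "0 < e"
    then have e: "0 < e / 3" by simp
    obtain M where M: "\<And>m n. m \<ge> M \<Longrightarrow> n \<ge> M \<Longrightarrow> norm (X m - X n) < e / 3"
      using CauchyD[OF X e] by blast
    obtain N where N: "\<And>n. n \<ge> N \<Longrightarrow> norm (of_alg_tensor (S n) - X n) < e / 3"
      using LIMSEQ_D[OF null e] by auto
    have "norm (of_alg_tensor (S m) - of_alg_tensor (S n)) < e"
      if "m \<ge> max M N" "n \<ge> max M N" for m n
    proof -
      have triangle: "norm (u + v - w) \<le> norm u + norm v + norm w"
        for u v w :: "('a, 'b) proj_tensor"
        using norm_triangle_ineq4[of "u + v" w] norm_triangle_ineq[of u v] by linarith
      have "norm (of_alg_tensor (S m) - of_alg_tensor (S n)) \<le>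
          norm (of_alg_tensor (S m) - X m) + norm (X m - X n) + norm (of_alg_tensor (S n) - X n)"
        using triangle[of "of_alg_tensor (S m) - X m" "X m - X n" "of_alg_tensor (S n) - X n"]
        by simp
      then show ?thesis using M[of m n] N[of m] N[of n] that by simp
    qed
    then show "\<exists>K. \<forall>m\<ge>K. \<forall>n\<ge>K. norm (of_alg_tensor (S m) - of_alg_tensor (S n)) < e" by blast
  qed
  then have "proj_Cauchy S"
    by (simp add: Cauchy_def proj_Cauchy_def dist_norm norm_of_alg_tensor
        flip: of_alg_tensor_diff)
  from tendsto_diff[OF of_alg_tensor_LIMSEQ[OF this] null]
  show "convergent X" by (auto simp: convergent_def)
qed

definition proj_tensor_pair ::
  "'a::real_normed_vector \<Rightarrow> 'b::real_normed_vector \<Rightarrow> ('a, 'b) proj_tensor"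
  where "proj_tensor_pair x y = of_alg_tensor (alg_tensor_pair x y)"


section \<open>Delta-points and the convex diametral local diameter two property\<close>

definition Delta_set :: "real \<Rightarrow> 'a::real_normed_vector \<Rightarrow> 'a set"
  where "Delta_set e x = {y \<in> cball 0 1. norm (x - y) \<ge> 2 - e}"

definition Delta_point :: "'a::real_normed_vector \<Rightarrow> bool"
  where "Delta_point x \<longleftrightarrow> x \<in> sphere 0 1 \<and> (\<forall>e>0. x \<in> closure (convex hull (Delta_set e x)))"

definition convex_DLD2P :: "'a::real_normed_vector itself \<Rightarrow> bool"
  where "convex_DLD2P (_ :: 'a itself) \<longleftrightarrow>
    (cball 0 1 :: 'a set) = closure (convex hull {x. Delta_point x})"

end

theory Submission
  imports Defs
begin

text \<open>
  For a unit vector \<open>y\<close>, the map \<open>z \<mapsto> z \<otimes> y\<close> is a linear isometry, so it carries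
  \<open>\<Delta>\<^sub>\<epsilon>(x)\<close> into \<open>\<Delta>\<^sub>\<epsilon>(x \<otimes> y)\<close> and hence \<open>\<Delta>\<close>-points \<open>x\<close> to \<open>\<Delta>\<close>-points \<open>x \<otimes> y\<close>. The convex
  DLD2P of \<open>X\<close> then puts \<open>x \<otimes> y\<close> into the closed convex hull of the \<open>\<Delta>\<close>-points for every \<open>x\<close> in
  the unit ball, and the unit ball of the projective tensor product is the closed convex hull
  of these tensors. That \<open>z \<mapsto> z \<otimes> y\<close> is isometric rests on the Hahn-Banach theorem.
\<close>

section \<open>Norming functionals\<close>

definition sublinear :: "('a::real_vector \<Rightarrow> real) \<Rightarrow> bool"
  where "sublinear p \<longleftrightarrow>
    (\<forall>u v. p (u + v) \<le> p u + p v) \<and> (\<forall>c\<ge>0. \<forall>v. p (c *\<^sub>R v) = c * p v)"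

lemma sublinear_add: "sublinear p \<Longrightarrow> p (u + v) \<le> p u + p v"
  and sublinear_scaleR: "sublinear p \<Longrightarrow> 0 \<le> c \<Longrightarrow> p (c *\<^sub>R v) = c * p v"
  by (auto simp: sublinear_def)

lemma sublinear_zero: "sublinear p \<Longrightarrow> p 0 = 0"
  using sublinear_scaleR[of p 0 0] by simp

lemma sublinear_neg_ge: "sublinear p \<Longrightarrow> - p (- v) \<le> p v"
  using sublinear_add[of p v "- v"] sublinear_zero[of p] by simp

lemma sublinear_norm: "sublinear norm"
  by (simp add: sublinear_def norm_triangle_ineq)

text \<open>Applying the inequality to \<open>inverse c\<close> and \<open>c *\<^sub>R v\<close>
  gives the reverse one, and the value at 0 covers \<open>c = 0\<close>.\<close>

lemma sublinearI:
  assumes add: "\<And>u v. p (u + v) \<le> p u + p v"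
    and zero: "p 0 = 0"
    and scaleR: "\<And>c v. 0 < c \<Longrightarrow> p (c *\<^sub>R v) \<le> c * p v"
  shows "sublinear p"
proof -
  have "p (c *\<^sub>R v) = c * p v" if "0 < c" for c v
  proof (rule antisym)
    have "c * p (inverse c *\<^sub>R c *\<^sub>R v) \<le> c * (inverse c * p (c *\<^sub>R v))"
      using that scaleR[of "inverse c" "c *\<^sub>R v"] by (intro mult_left_mono) auto
    then show "c * p v \<le> p (c *\<^sub>R v)" using that by (simp flip: mult.assoc)
  qed (rule scaleR[OF that])
  then show ?thesis
    by (simp add: sublinear_def add) (auto simp: zero order_le_less)
qed

text \<open>This yields subadditivity of functionals defined by infima: the two infima are bounded
  one after the other.\<close>

lemma le_cINF_add:
  fixes f g :: "'i \<Rightarrow> real"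
  assumes "I \<noteq> {}" "J \<noteq> {}"
    and le: "\<And>i j. i \<in> I \<Longrightarrow> j \<in> J \<Longrightarrow> a \<le> f i + g j"
  shows "a \<le> (INF i\<in>I. f i) + (INF j\<in>J. g j)"
proof -
  have "a - g j \<le> (INF i\<in>I. f i)" if "j \<in> J" for j
    using assms(1) le[OF _ that] by (intro cINF_greatest) (auto simp: algebra_simps)
  then have "a - (INF i\<in>I. f i) \<le> (INF j\<in>J. g j)"
    using assms(2) by (intro cINF_greatest) (auto simp: algebra_simps)
  then show ?thesis by simp
qed

lemma le_mult_cINF:
  fixes f :: "'i \<Rightarrow> real"
  assumes "I \<noteq> {}" "0 < c" and le: "\<And>i. i \<in> I \<Longrightarrow> a \<le> c * f i"
  shows "a \<le> c * (INF i\<in>I. f i)"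
proof -
  have "a / c \<le> (INF i\<in>I. f i)"
    using assms by (intro cINF_greatest) (auto simp: field_simps)
  then show ?thesis using assms(2) by (simp add: field_simps)
qed

text \<open>For sublinear \<open>p\<close>, this is the largest sublinear functional below
  \<open>p\<close> whose value at \<open>- w\<close> is at most \<open>- p w\<close>.\<close>

definition sublinear_shear :: "('a::real_vector \<Rightarrow> real) \<Rightarrow> 'a \<Rightarrow> 'a \<Rightarrow> real"
  where "sublinear_shear p w v = (INF t\<in>{0..}. p (v + t *\<^sub>R w) - t * p w)"

text \<open>The infimum is genuine because \<open>- p (- v)\<close> bounds all terms from below:
  \<open>t *\<^sub>R w\<close> is the sum of \<open>v + t *\<^sub>R w\<close> and
  \<open>- v\<close>.\<close>

lemma sublinear_shear_le:
  assumes p: "sublinear p" and "0 \<le> t"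
  shows "sublinear_shear p w v \<le> p (v + t *\<^sub>R w) - t * p w"
  unfolding sublinear_shear_def
proof (rule cINF_lower)
  show "bdd_below ((\<lambda>t. p (v + t *\<^sub>R w) - t * p w) ` {0..})"
  proof (rule bdd_belowI2)
    fix t :: real
    assume "t \<in> {0..}"
    then show "- p (- v) \<le> p (v + t *\<^sub>R w) - t * p w"
      using sublinear_add[OF p, of "v + t *\<^sub>R w" "- v"] sublinear_scaleR[OF p, of t w] by simp
  qed
qed (use assms in simp)

lemma sublinear_shear_le_self: "sublinear p \<Longrightarrow> sublinear_shear p w v \<le> p v"
  using sublinear_shear_le[of p 0 w v] by simp

lemma sublinear_shear_neg: "sublinear p \<Longrightarrow> sublinear_shear p w (- w) \<le> - p w"
  using sublinear_shear_le[of p 1 w "- w"] by (simp add: sublinear_zero)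

lemma sublinear_sublinear_shear:
  assumes p: "sublinear p"
  shows "sublinear (sublinear_shear p w)"
proof (rule sublinearI)
  fix u v
  \<comment> \<open>The parameters of the two infima add up: \<open>s + t\<close> is admissible for
    \<open>u + v\<close>.\<close>
  have "sublinear_shear p w (u + v) \<le> (p (u + s *\<^sub>R w) - s * p w) + (p (v + t *\<^sub>R w) - t * p w)"
    if "0 \<le> s" "0 \<le> t" for s t
    using sublinear_shear_le[OF p, of "s + t" w "u + v"] that
      sublinear_add[OF p, of "u + s *\<^sub>R w" "v + t *\<^sub>R w"]
    by (simp add: algebra_simps)
  then show "sublinear_shear p w (u + v) \<le> sublinear_shear p w u + sublinear_shear p w v"
    unfolding sublinear_shear_def[of p w u] sublinear_shear_def[of p w v]
    by (intro le_cINF_add) auto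
next
  show "sublinear_shear p w 0 = 0"
    by (simp add: sublinear_shear_def sublinear_scaleR[OF p] cong: INF_cong_simp)
next
  fix c :: real and v
  assume c: "0 < c"
  \<comment> \<open>Scaling \<open>v\<close> by \<open>c\<close> turns the parameter
    \<open>t\<close> into \<open>c * t\<close>.\<close>
  have "sublinear_shear p w (c *\<^sub>R v) \<le> c * (p (v + t *\<^sub>R w) - t * p w)" if "0 \<le> t" for t
    using sublinear_shear_le[OF p, of "c * t" w "c *\<^sub>R v"] that c
      sublinear_scaleR[OF p, of c "v + t *\<^sub>R w"]
    by (simp add: algebra_simps)
  then show "sublinear_shear p w (c *\<^sub>R v) \<le> c * sublinear_shear p w v"
    unfolding sublinear_shear_def[of p w v] using c by (intro le_mult_cINF) auto
qed

text \<open>Provides the lower bounds of chains for Zorn's lemma. The common bound \<open>p0\<close>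
  keeps the infima finite, and of two comparable functionals the smaller one serves at both
  \<open>u\<close> and \<open>v\<close>.\<close>

lemma sublinear_INF_chain:
  assumes C: "C \<noteq> {}" "\<And>p. p \<in> C \<Longrightarrow> sublinear p"
    and chain: "\<And>p q. p \<in> C \<Longrightarrow> q \<in> C \<Longrightarrow> p \<le> q \<or> q \<le> p"
    and bound: "\<And>p. p \<in> C \<Longrightarrow> p \<le> p0"
  shows "sublinear (\<lambda>v. INF p\<in>C. p v)" (is "sublinear ?q")
    and "p \<in> C \<Longrightarrow> (\<lambda>v. INF p\<in>C. p v) \<le> p"
proof -
  have bdd: "bdd_below ((\<lambda>p. p v) ` C)" for v
  proof (rule bdd_belowI2)
    fix p
    assume "p \<in> C"
    then show "- p0 (- v) \<le> p v"
      using sublinear_neg_ge[of p v] C(2) bound[THEN le_funD, of p "- v"] by fastforce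
  qed
  have le: "?q v \<le> p v" if "p \<in> C" for p v
    by (rule cINF_lower[OF bdd that])
  then show "p \<in> C \<Longrightarrow> ?q \<le> p" by (simp add: le_fun_def)
  show "sublinear ?q"
  proof (rule sublinearI)
    fix u v
    have "?q (u + v) \<le> p u + q v" if pq: "p \<in> C" "q \<in> C" for p q
      using chain[OF pq]
    proof
      assume "p \<le> q"
      then show ?thesis
        using le[OF pq(1), of "u + v"] sublinear_add[OF C(2)[OF pq(1)], of u v]
          le_funD[of p q v] by linarith
    next
      assume "q \<le> p"
      then show ?thesis
        using le[OF pq(2), of "u + v"] sublinear_add[OF C(2)[OF pq(2)], of u v]
          le_funD[of q p u] by linarith
    qed
    then show "?q (u + v) \<le> ?q u + ?q v"
      using C(1) by (intro le_cINF_add)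
  next
    show "?q 0 = 0"
      using C by (simp add: sublinear_zero cong: INF_cong_simp)
  next
    fix c :: real and v
    assume c: "0 < c"
    have "?q (c *\<^sub>R v) \<le> c * p v" if "p \<in> C" for p
      using le[OF that, of "c *\<^sub>R v"] sublinear_scaleR[OF C(2)[OF that], of c v] c by simp
    then show "?q (c *\<^sub>R v) \<le> c * ?q v"
      using C(1) c by (intro le_mult_cINF)
  qed
qed

text \<open>
  A pointwise minimal sublinear functional coincides with all its shears, which makes it odd
  and therefore linear.
\<close>

theorem Hahn_Banach_sublinear:
  assumes p0: "sublinear p0"
  obtains f where "linear f" "\<And>v. f v \<le> p0 v"
proof -
  let ?A = "{p. sublinear p \<and> p \<le> p0}"
  \<comment> \<open>The order is reversed so that Zorn's lemma yields a minimal element.\<close>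
  have "\<exists>m\<in>?A. \<forall>a\<in>?A. m \<ge> a \<longrightarrow> a = m"
  proof (rule predicate_Zorn)
    show "partial_order_on ?A (relation_of (\<ge>) ?A)"
      by (rule partial_order_on_relation_ofI) auto
  next
    fix C
    assume "C \<in> Chains (relation_of (\<ge>) ?A)"
    then have C: "C \<subseteq> ?A" and chain: "\<And>p q. p \<in> C \<Longrightarrow> q \<in> C \<Longrightarrow> p \<le> q \<or> q \<le> p"
      by (auto simp: Chains_def relation_of_def)
    show "\<exists>u\<in>?A. \<forall>a\<in>C. a \<ge> u"
    proof (cases "C = {}")
      case True
      then show ?thesis using p0 by auto
    next
      case False
      then obtain p where "p \<in> C" by blast
      note INF = sublinear_INF_chain[of C p0, OF False _ chain]
      show ?thesis
      proof (intro bexI ballI)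
        show "(\<lambda>v. INF p\<in>C. p v) \<in> ?A"
          using INF(1) INF(2)[OF _ _ _ _ \<open>p \<in> C\<close>] C \<open>p \<in> C\<close> by (blast intro: order_trans)
        show "(\<lambda>v. INF p\<in>C. p v) \<le> a" if "a \<in> C" for a
          using INF(2)[OF _ _ _ _ that] C by blast
      qed
    qed
  qed
  then obtain f where f: "sublinear f" "f \<le> p0"
    and minimal: "\<And>q. sublinear q \<Longrightarrow> q \<le> f \<Longrightarrow> q = f"
    by (auto intro: order_trans)
  have neg: "f (- w) = - f w" for w
  proof -
    have "sublinear_shear f w = f"
      using sublinear_sublinear_shear[OF f(1)] sublinear_shear_le_self[OF f(1)]
      by (intro minimal) (auto simp: le_fun_def)
    then show ?thesis
      using sublinear_shear_neg[OF f(1), of w] sublinear_neg_ge[OF f(1), of w] by simp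
  qed
  have "linear f"
  proof (rule linearI)
    fix u v
    \<comment> \<open>Oddness turns \<open>f u \<le> f (u + v) + f (- v)\<close> into the reverse of
      subadditivity.\<close>
    show "f (u + v) = f u + f v"
      using sublinear_add[OF f(1), of u v] sublinear_add[OF f(1), of "u + v" "- v"] neg[of v]
      by simp
  next
    fix c v
    show "f (c *\<^sub>R v) = c *\<^sub>R f v"
      using sublinear_scaleR[OF f(1), of c v] sublinear_scaleR[OF f(1), of "- c" v]
        neg[of "c *\<^sub>R v"]
      by (cases "0 \<le> c") auto
  qed
  then show thesis using that f(2) by (auto simp: le_fun_def)
qed

text \<open>Domination by the shear of the norm along \<open>y\<close> forces
  \<open>f (- y) \<le> - norm y\<close>, hence \<open>f y = norm y\<close>, while \<open>f\<close>
  stays below the norm.\<close>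

corollary norming_functional:
  fixes y :: "'a::real_normed_vector"
  obtains f where "linear f" "f y = norm y" "\<And>v. \<bar>f v\<bar> \<le> norm v"
proof -
  obtain f where f: "linear f" "\<And>v. f v \<le> sublinear_shear norm y v"
    using Hahn_Banach_sublinear[OF sublinear_sublinear_shear[OF sublinear_norm, of y]] by blast
  have le: "f v \<le> norm v" for v
    using f(2)[of v] sublinear_shear_le_self[OF sublinear_norm, of y v] by simp
  have "norm y \<le> f y"
    using f(2)[of "- y"] sublinear_shear_neg[OF sublinear_norm, of y] linear_neg[OF f(1), of y]
    by simp
  then have "f y = norm y" using le[of y] by simp
  moreover have "\<bar>f v\<bar> \<le> norm v" for v
    using le[of v] le[of "- v"] linear_neg[OF f(1), of v] by simp
  ultimately show thesis using that f(1) by blast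
qed


section \<open>The projective norm of elementary tensors\<close>

definition free_extension ::
  "('a \<Rightarrow> 'b \<Rightarrow> 'c::real_vector) \<Rightarrow> (('a \<times> 'b) \<Rightarrow>\<^sub>0 real) \<Rightarrow> 'c"
  where "free_extension h u =
    (\<Sum>(x, y)\<in>Poly_Mapping.keys u. Poly_Mapping.lookup u (x, y) *\<^sub>R h x y)"

text \<open>A common finite index set makes sums over different supports comparable, as the proof of
  linearity requires.\<close>

lemma free_extension_superset:
  assumes "finite K" "Poly_Mapping.keys u \<subseteq> K"
  shows "free_extension h u = (\<Sum>(x, y)\<in>K. Poly_Mapping.lookup u (x, y) *\<^sub>R h x y)"
  unfolding free_extension_def
  by (rule sum.mono_neutral_left[OF assms]) (auto simp: in_keys_iff)

lemma free_extension_free_pair: "free_extension h (free_pair x y) = h x y"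
  by (simp add: free_extension_def free_pair_def)

lemma linear_free_extension: "linear (free_extension h)"
proof (rule linearI)
  fix u v :: "('a \<times> 'b) \<Rightarrow>\<^sub>0 real"
  let ?K = "Poly_Mapping.keys u \<union> Poly_Mapping.keys v"
  have "free_extension h w = (\<Sum>(x, y)\<in>?K. Poly_Mapping.lookup w (x, y) *\<^sub>R h x y)"
    if "Poly_Mapping.keys w \<subseteq> ?K" for w
    using that by (intro free_extension_superset) auto
  note * = this[of "u + v"] this[of u] this[of v]
  show "free_extension h (u + v) = free_extension h u + free_extension h v"
    using keys_add[of u v]
    by (simp add: * lookup_add case_prod_beta scaleR_add_left sum.distrib)
next
  fix c :: real and u :: "('a \<times> 'b) \<Rightarrow>\<^sub>0 real"
  have "Poly_Mapping.keys (c *\<^sub>R u) \<subseteq> Poly_Mapping.keys u"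
    by (auto simp: in_keys_iff lookup_scaleR)
  then show "free_extension h (c *\<^sub>R u) = c *\<^sub>R free_extension h u"
    using free_extension_superset[of "Poly_Mapping.keys u" "c *\<^sub>R u" h]
    by (simp add: free_extension_def lookup_scaleR case_prod_beta scaleR_sum_right)
qed

text \<open>Bilinearity of \<open>h\<close> makes the linear extension vanish on every relator,
  hence on their span, so it descends to the quotient.\<close>

lemma free_extension_tensor_eq:
  assumes h: "bilinear h" and uv: "tensor_eq u v"
  shows "free_extension h u = free_extension h v"
proof -
  interpret L: linear "free_extension h" by (rule linear_free_extension)
  have "free_extension h (u - v) = 0"
  proof (rule linear_eq_0_on_span[OF linear_free_extension _ uv[unfolded tensor_eq_def]])
    fix w :: "('a \<times> 'b) \<Rightarrow>\<^sub>0 real"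
    assume "w \<in> bilinear_relators"
    then show "free_extension h w = 0"
      unfolding bilinear_relators_def
      by (auto simp: L.diff L.scaleR free_extension_free_pair bilinear_ladd[OF h]
          bilinear_radd[OF h] bilinear_lmul[OF h] bilinear_rmul[OF h])
  qed
  then show ?thesis by (simp add: L.diff)
qed

lemma alg_tensor_universal:
  assumes h: "bilinear h"
  obtains L where "linear L" "\<And>x y. L (alg_tensor_pair x y) = h x y"
proof
  let ?L = "\<lambda>u. free_extension h (rep_alg_tensor u)"
  \<comment> \<open>The chosen representative of the class of \<open>u\<close> may differ from
    \<open>u\<close>, but only up to \<open>tensor_eq\<close>.\<close>
  have rep: "?L (abs_alg_tensor u) = free_extension h u" for u
    using free_extension_tensor_eq[OF h] Quotient3_alg_tensor
    by (metis Quotient3_rel_rep Quotient3_rep_abs equivp_reflp equivp_tensor_eq)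
  show "linear ?L"
  proof (rule linearI)
    fix u v :: "('a, 'b) alg_tensor"
    show "?L (u + v) = ?L u + ?L v"
      by (induction u rule: alg_tensor.abs_induct, induction v rule: alg_tensor.abs_induct)
        (simp add: plus_alg_tensor.abs_eq rep linear_add[OF linear_free_extension])
  next
    fix c :: real and u :: "('a, 'b) alg_tensor"
    show "?L (c *\<^sub>R u) = c *\<^sub>R ?L u"
      by (induction u rule: alg_tensor.abs_induct)
        (simp add: scaleR_alg_tensor.abs_eq rep linear_scale[OF linear_free_extension])
  qed
  show "?L (alg_tensor_pair x y) = h x y" for x y
    by (simp add: alg_tensor_pair.abs_eq rep free_extension_free_pair)
qed

text \<open>
  A norming functional \<open>f\<close> of \<open>y\<close> turns the lower bound into the triangle inequality for the
  image of a representation under \<open>x \<otimes> y \<mapsto> f y *\<^sub>R x\<close>.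
\<close>

lemma proj_norm_pair: "proj_norm (alg_tensor_pair x y) = norm x * norm y"
proof (rule antisym)
  show "proj_norm (alg_tensor_pair x y) \<le> norm x * norm y"
    using proj_norm_le[of _ "[(x, y)]"] by simp
  show "norm x * norm y \<le> proj_norm (alg_tensor_pair x y)"
  proof (rule proj_norm_greatest)
    fix ps
    assume ps: "alg_tensor_pair x y = (\<Sum>(x, y)\<leftarrow>ps. alg_tensor_pair x y)"
    obtain f where f: "linear f" "f y = norm y" "\<And>v. \<bar>f v\<bar> \<le> norm v"
      using norming_functional[of y] by blast
    have "bilinear (\<lambda>(x::'a) y. f y *\<^sub>R x)"
      by (auto simp: bilinear_def intro!: linearI
          simp: linear_add[OF f(1)] linear_scale[OF f(1)] algebra_simps)
    then obtain L :: "('a, 'b) alg_tensor \<Rightarrow> 'a"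
      where L: "linear L" "\<And>x y. L (alg_tensor_pair x y) = f y *\<^sub>R x"
      using alg_tensor_universal by blast
    have "norm (L (\<Sum>(x, y)\<leftarrow>ps. alg_tensor_pair x y)) \<le> (\<Sum>(x, y)\<leftarrow>ps. norm x * norm y)"
    proof (induction ps)
      case Nil
      then show ?case by (simp add: linear_0[OF L(1)])
    next
      case (Cons p ps)
      obtain x y where p: "p = (x, y)" by (cases p)
      have "norm (f y *\<^sub>R x) \<le> norm x * norm y"
        using f(3)[of y] by (simp add: mult.commute mult_left_mono)
      then show ?case
        using norm_triangle_mono[OF _ Cons] by (simp add: p linear_add[OF L(1)] L(2))
    qed
    \<comment> \<open>By the choice of \<open>f\<close>, \<open>L\<close> sends
      \<open>alg_tensor_pair x y\<close> to \<open>norm y *\<^sub>R x\<close>.\<close>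
    then show "norm x * norm y \<le> (\<Sum>(x, y)\<leftarrow>ps. norm x * norm y)"
      using f(2) by (simp add: L(2) mult.commute flip: ps)
  qed
qed

lemma norm_proj_tensor_pair: "norm (proj_tensor_pair x y) = norm x * norm y"
  by (simp add: proj_tensor_pair_def norm_of_alg_tensor proj_norm_pair)

lemma bounded_linear_proj_tensor_pair: "bounded_linear (\<lambda>x. proj_tensor_pair x y)"
  by (rule bounded_linear_intro[where K = "norm y"])
    (simp_all add: proj_tensor_pair_def alg_tensor_pair_add_left alg_tensor_pair_scaleR_left
      linear_add[OF linear_of_alg_tensor] linear_scale[OF linear_of_alg_tensor]
      norm_of_alg_tensor proj_norm_pair)


section \<open>Delta-points of the projective tensor product\<close>

text \<open>Linear maps commute with convex hulls, and continuous maps send closures into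
  closures.\<close>

lemma bounded_linear_closure_convex_hull:
  assumes f: "bounded_linear f" and "x \<in> closure (convex hull S)"
  shows "f x \<in> closure (convex hull (f ` S))"
  using closure_bounded_linear_image_subset[OF f, of "convex hull S"] assms(2)
    convex_hull_linear_image[OF bounded_linear.linear[OF f], of S]
  by auto

lemma closure_convex_hull_mono: "S \<subseteq> T \<Longrightarrow> closure (convex hull S) \<subseteq> closure (convex hull T)"
  by (intro closure_mono hull_mono)

lemma Delta_point_proj_tensor_pair:
  assumes x: "Delta_point x" and y: "norm y = 1"
  shows "Delta_point (proj_tensor_pair x y)"
  unfolding Delta_point_def
proof (intro conjI allI impI)
  let ?T = "\<lambda>z. proj_tensor_pair z y"
  interpret T: bounded_linear ?T by (rule bounded_linear_proj_tensor_pair)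
  show "?T x \<in> sphere 0 1"
    using x y by (simp add: Delta_point_def norm_proj_tensor_pair)
  fix e :: real
  assume "0 < e"
  then have "x \<in> closure (convex hull Delta_set e x)"
    using x by (simp add: Delta_point_def)
  then have "?T x \<in> closure (convex hull (?T ` Delta_set e x))"
    by (rule bounded_linear_closure_convex_hull[OF bounded_linear_proj_tensor_pair])
  moreover have "?T ` Delta_set e x \<subseteq> Delta_set e (?T x)"
    by (auto simp: Delta_set_def norm_proj_tensor_pair y simp flip: T.diff)
  ultimately show "?T x \<in> closure (convex hull (Delta_set e (?T x)))"
    using closure_convex_hull_mono by blast
qed

section \<open>The unit ball as a closed convex hull of elementary tensors\<close>

lemma convex_cone_combination:
  assumes "convex K" "k \<in> K" "l \<in> K" "0 \<le> a" "0 \<le> b"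
  shows "\<exists>m\<in>K. a *\<^sub>R k + b *\<^sub>R l = (a + b) *\<^sub>R m"
proof (cases "a + b = 0")
  case True
  then have "a = 0" "b = 0" using assms(4,5) by simp_all
  then show ?thesis using assms(2) by auto
next
  case False
  \<comment> \<open>Dividing by \<open>a + b\<close> turns the nonnegative weights into convex
    ones.\<close>
  then have "(a / (a + b)) *\<^sub>R k + (b / (a + b)) *\<^sub>R l \<in> K"
    using assms False by (intro convexD) (simp_all flip: add_divide_distrib)
  moreover have "a *\<^sub>R k + b *\<^sub>R l = (a + b) *\<^sub>R ((a / (a + b)) *\<^sub>R k + (b / (a + b)) *\<^sub>R l)"
    using False by (simp add: scaleR_add_right)
  ultimately show ?thesis by blast
qed

text \<open>An algebraic tensor of norm less than 1 has a representation of cost less than 1, which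
  makes it a convex combination of normalized pairs and 0. Density and closedness give the
  rest.\<close>

lemma cball_proj_tensor_subset:
  fixes K :: "('a::real_normed_vector, 'b::real_normed_vector) proj_tensor set"
  assumes K: "closed K" "convex K" "0 \<in> K"
    and pair: "\<And>x y. norm x \<le> 1 \<Longrightarrow> norm y = 1 \<Longrightarrow> proj_tensor_pair x y \<in> K"
  shows "cball 0 1 \<subseteq> K"
proof -
  \<comment> \<open>The coefficient of \<open>k\<close> is kept equal to the cost, so that it falls
    below 1 for a good representation.\<close>
  have sum: "\<exists>k\<in>K. of_alg_tensor (\<Sum>(x, y)\<leftarrow>ps. alg_tensor_pair x y) =
      (\<Sum>(x, y)\<leftarrow>ps. norm x * norm y) *\<^sub>R k" for ps
  proof (induction ps)
    case Nil
    then show ?case using K(3) by (auto simp: linear_0[OF linear_of_alg_tensor])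
  next
    case (Cons p ps)
    obtain x y where p: "p = (x, y)" by (cases p)
    have "\<exists>k\<in>K. of_alg_tensor (alg_tensor_pair x y) = (norm x * norm y) *\<^sub>R k"
    proof (cases "norm x * norm y = 0")
      case True
      then have "of_alg_tensor (alg_tensor_pair x y) = 0"
        using norm_of_alg_tensor[of "alg_tensor_pair x y"] by (auto simp: proj_norm_pair)
      then show ?thesis using True K(3) by auto
    next
      case False
      let ?x = "x /\<^sub>R norm x" and ?y = "y /\<^sub>R norm y"
      have "of_alg_tensor (alg_tensor_pair x y) = (norm x * norm y) *\<^sub>R proj_tensor_pair ?x ?y"
        using False
        by (simp add: proj_tensor_pair_def alg_tensor_pair_scaleR_left alg_tensor_pair_scaleR_right
            linear_scale[OF linear_of_alg_tensor] field_simps)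
      moreover have "proj_tensor_pair ?x ?y \<in> K"
        using False by (intro pair) auto
      ultimately show ?thesis by blast
    qed
    then obtain k where k: "k \<in> K"
      "of_alg_tensor (alg_tensor_pair x y) = (norm x * norm y) *\<^sub>R k" by blast
    obtain l where l: "l \<in> K" "of_alg_tensor (\<Sum>(x, y)\<leftarrow>ps. alg_tensor_pair x y) =
        (\<Sum>(x, y)\<leftarrow>ps. norm x * norm y) *\<^sub>R l" using Cons by blast
    show ?case
      using convex_cone_combination[OF K(2) k(1) l(1) _ proj_cost_nonneg, of "norm x * norm y" ps]
      by (simp add: p linear_add[OF linear_of_alg_tensor] k(2) l(2))
  qed
  have "of_alg_tensor s \<in> K" if "norm (of_alg_tensor s) < 1" for s :: "('a, 'b) alg_tensor"
  proof -
    have "0 < 1 - proj_norm s" using that by (simp add: norm_of_alg_tensor)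
    then obtain ps where ps: "s = (\<Sum>(x, y)\<leftarrow>ps. alg_tensor_pair x y)"
      and cost: "(\<Sum>(x, y)\<leftarrow>ps. norm x * norm y) < proj_norm s + (1 - proj_norm s)" (is "?c < _")
      by (rule proj_norm_approx)
    obtain k where k: "k \<in> K" "of_alg_tensor s = ?c *\<^sub>R k"
      using sum[of ps] ps by blast
    \<comment> \<open>The missing mass \<open>1 - ?c\<close> is put on 0, which lies in
      \<open>K\<close>.\<close>
    have "?c *\<^sub>R k + (1 - ?c) *\<^sub>R 0 \<in> K"
      using K k(1) cost proj_cost_nonneg[of ps] by (intro convexD) auto
    then show ?thesis using k(2) by simp
  qed
  then have "ball 0 1 \<inter> range of_alg_tensor \<subseteq> K" by auto
  \<comment> \<open>A dense set meets an open set in a dense subset of it.\<close>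
  moreover have "ball 0 1 \<subseteq> closure (ball 0 1 \<inter> range of_alg_tensor)"
    using open_Int_closure_subset[of "ball 0 1" "range of_alg_tensor"]
    by (simp add: of_alg_tensor_dense)
  ultimately have "ball 0 1 \<subseteq> K"
    using closure_minimal[OF _ K(1)] by blast
  \<comment> \<open>The closed unit ball is the closure of the open one.\<close>
  then show ?thesis
    using closure_minimal[OF _ K(1), of "ball 0 1"] by simp
qed

theorem proposition5p3:
  assumes X_nontrivial: "(UNIV :: 'x::banach set) \<noteq> {0}"
    and Y_nontrivial: "(UNIV :: 'y::banach set) \<noteq> {0}"
    and X_convex_DLD2P: "convex_DLD2P TYPE('x)"
  shows "convex_DLD2P TYPE(('x, 'y) proj_tensor)"
  unfolding convex_DLD2P_def
proof (rule antisym)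
  let ?K = "closure (convex hull {u :: ('x, 'y) proj_tensor. Delta_point u})"
  have pair: "proj_tensor_pair x y \<in> ?K" if "norm x \<le> 1" "norm y = 1" for x :: 'x and y :: 'y
  proof -
    let ?T = "\<lambda>z. proj_tensor_pair z y"
    have "x \<in> closure (convex hull {x. Delta_point x})"
      using that(1) by (simp flip: X_convex_DLD2P[unfolded convex_DLD2P_def])
    then have "?T x \<in> closure (convex hull (?T ` {x. Delta_point x}))"
      by (rule bounded_linear_closure_convex_hull[OF bounded_linear_proj_tensor_pair])
    moreover have "?T ` {x. Delta_point x} \<subseteq> {u. Delta_point u}"
      using Delta_point_proj_tensor_pair that(2) by blast
    ultimately show ?thesis using closure_convex_hull_mono by blast
  qed
  \<comment> \<open>A unit vector of \<open>'y\<close> exhibits 0 as an elementary tensor covered by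
    \<open>pair\<close>.\<close>
  obtain y :: 'y where "y \<noteq> 0" using Y_nontrivial by auto
  then have "norm (y /\<^sub>R norm y) = 1" by simp
  from pair[OF _ this, of 0] have "0 \<in> ?K"
    by (simp add: linear_0[OF bounded_linear.linear[OF bounded_linear_proj_tensor_pair]])
  then show "cball 0 1 \<subseteq> ?K"
    by (intro cball_proj_tensor_subset pair) (auto intro: convex_closure)
  show "?K \<subseteq> cball 0 1"
    by (intro closure_minimal hull_minimal) (auto simp: Delta_point_def)
qed

end
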